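(* (Exponential decay.) Let $r\in\ell^2(\mathbb Z)$ be a minimiser of $\tilde E_\infty$. Let $C\ge0$ be a constant such that $0\ge\Phi_2''(t)\ge-C$ for all $t\in(-|r_1|,|r_1|)$ at which $\Phi_2$ is defined (i.e. $F_0+t>0$). Then, with $\lambda:=\frac{C}{l+C}$, $$|r_i|\le\lambda^{i-1}|r_1|\qquad\text{for all integers } i\ge1$$ (with $\lambda^0=1$).
   Context: Potentials. $\phi_1,\phi_2$ (pure) and $\psi_1,\psi_2$ (defect) are $C^2$ on $(0,\infty)$ and satisfy, for some $l>0$, $\alpha\in(0,1)$, $C_0\in\mathbb R$: (1) $\phi_1(t)=\psi_1(t)=+\infty$ for $t\le0$, and $\phi_1(t),\psi_1(t)\to+\infty$ as $t\searrow0$; (2) $\phi_1''(t),\psi_1''(t)\ge l$ for all $t>0$; (3) $\phi_2,\psi_2$ are concave on $(0,\infty)$; (4) for $x>0$: $\phi_2(x)\ge-\alpha\phi_1(x)+C_0$, $\phi_2(x)\ge-\alpha\psi_1(x)+C_0$, $\psi_2(x)\ge-\alpha\phi_1(x)+C_0$, $\psi_2(x)\ge-\alpha\psi_1(x)+C_0$; (5) $W:=\phi_1+\phi_2$ satisfies $W''(t)\ge l$ for all $t>0$ (and $W(t)=+\infty$ for $t\le0$). Let $L>0$, $\Omega=[-\frac12,\frac12]$, $f\in C^2(\Omega)$, $\mathcal A(L)=\{y\in H^1(\Omega):y(-\frac12)=0,\ y(\frac12)=L\}$. The functional $\mathcal F_0(y)=\int_\Omega W(Dy)+f\,(y-L(x+\frac12))\,dx$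 on $\mathcal A(L)$ has a unique minimiser $\bar y$, which lies in $C^2(\Omega)$ with $D\bar y>0$. Put $F_0:=D\bar y(0)>0$. Cell problem. Let $\Phi_j(t)=\phi_j(F_0+t)-\phi_j(F_0)-\phi_j'(F_0)t$ for $j=1,2$. For $r\in\ell^2(\mathbb Z)$, $$\tilde E_\infty(r)=\sum_{i=-\infty}^\infty\Big(\Phi_1(r_i)+\Phi_2\big(\tfrac{r_i+r_{i+1}}2\big)\Big)+\tilde E_d(r),$$ $$\tilde E_d(r)=\psi_2(F_0+\tfrac{r_{-2}+r_{-1}}2)-\phi_2(F_0+\tfrac{r_{-2}+r_{-1}}2)+\psi_1(F_0+r_{-1})-\phi_1(F_0+r_{-1})+\psi_1(F_0+r_0)-\phi_1(F_0+r_0)+\psi_2(F_0+\tfrac{r_0+r_1}2)-\phi_2(F_0+\tfrac{r_0+r_1}2),$$ with $\tilde E_\infty(r):=+\infty$ if $F_0+r_i\le0$ for some $i$. *)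

theory Defs
  imports "HOL-Analysis.Analysis"
begin

definition C2_on :: "real set \<Rightarrow> (real \<Rightarrow> real) \<Rightarrow> bool" where
  "C2_on S f \<longleftrightarrow>
     (\<exists>f' f''. (\<forall>x\<in>S. (f has_real_derivative f' x) (at x within S)) \<and>
               (\<forall>x\<in>S. (f' has_real_derivative f'' x) (at x within S)) \<and>
               continuous_on S f'')"


subsection \<open>Interaction potentials\<close>

text \<open>
  A potential is given by its real values on \<open>(0,\<infinity>)\<close>; the values of the underlying total
  function on \<open>(-\<infinity>,0]\<close> are never used.  The convention that \<open>\<phi>1\<close>, \<open>\<psi>1\<close> and \<open>W\<close> are \<open>+\<infinity>\<close> on
  \<open>(-\<infinity>,0]\<close> enters through \<open>ext_pot\<close> in the continuum functional and through the case
  distinction in \<open>cell_energy\<close>.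
\<close>

definition ext_pot :: "(real \<Rightarrow> real) \<Rightarrow> real \<Rightarrow> ereal" where
  "ext_pot w t = (if t > 0 then ereal (w t) else \<infinity>)"

definition admissible_potentials ::
  "(real \<Rightarrow> real) \<Rightarrow> (real \<Rightarrow> real) \<Rightarrow> (real \<Rightarrow> real) \<Rightarrow> (real \<Rightarrow> real)
     \<Rightarrow> real \<Rightarrow> real \<Rightarrow> real \<Rightarrow> bool" where
  "admissible_potentials \<phi>1 \<phi>2 \<psi>1 \<psi>2 l \<alpha> C0 \<longleftrightarrow>
     l > 0 \<and> 0 < \<alpha> \<and> \<alpha> < 1 \<and>
     C2_on {0<..} \<phi>1 \<and> C2_on {0<..} \<phi>2 \<and> C2_on {0<..} \<psi>1 \<and> C2_on {0<..} \<psi>2 \<and>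
     filterlim \<phi>1 at_top (at_right 0) \<and> filterlim \<psi>1 at_top (at_right 0) \<and>
     (\<forall>t>0. deriv (deriv \<phi>1) t \<ge> l \<and> deriv (deriv \<psi>1) t \<ge> l) \<and>
     concave_on {0<..} \<phi>2 \<and> concave_on {0<..} \<psi>2 \<and>
     (\<forall>x>0. \<phi>2 x \<ge> - \<alpha> * \<phi>1 x + C0 \<and> \<phi>2 x \<ge> - \<alpha> * \<psi>1 x + C0 \<and>
            \<psi>2 x \<ge> - \<alpha> * \<phi>1 x + C0 \<and> \<psi>2 x \<ge> - \<alpha> * \<psi>1 x + C0) \<and>
     (\<forall>t>0. deriv (deriv (\<lambda>s. \<phi>1 s + \<phi>2 s)) t \<ge> l)"


subsection \<open>The continuum problem\<close>

definition Omega :: "real set" where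
  "Omega = {-1/2..1/2}"

definition L2_Omega :: "(real \<Rightarrow> real) \<Rightarrow> bool" where
  "L2_Omega g \<longleftrightarrow> g \<in> borel_measurable (lebesgue_on Omega) \<and>
                  integrable (lebesgue_on Omega) (\<lambda>x. (g x)\<^sup>2)"

definition test_function :: "(real \<Rightarrow> real) \<Rightarrow> bool" where
  "test_function v \<longleftrightarrow>
     (\<forall>n x. (deriv ^^ n) v field_differentiable (at x)) \<and>
     (\<exists>a b. -1/2 < a \<and> a \<le> b \<and> b < 1/2 \<and> (\<forall>x. x \<notin> {a..b} \<longrightarrow> v x = 0))"

definition weak_deriv :: "(real \<Rightarrow> real) \<Rightarrow> (real \<Rightarrow> real) \<Rightarrow> bool" where
  "weak_deriv y g \<longleftrightarrow> L2_Omega g \<and>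
     (\<forall>v. test_function v \<longrightarrow>
        (LINT x|lebesgue_on Omega. y x * deriv v x) = - (LINT x|lebesgue_on Omega. g x * v x))"

definition H1_Omega :: "(real \<Rightarrow> real) set" where
  "H1_Omega = {y. L2_Omega y \<and> (\<exists>g. weak_deriv y g)}"

text \<open>
  The boundary conditions refer to the continuous representative of an \<open>H\<^sup>1\<close> function, so
  admissible deformations are taken to be continuous.
\<close>

definition deformations :: "real \<Rightarrow> (real \<Rightarrow> real) set" where
  "deformations L = {y \<in> H1_Omega. continuous_on Omega y \<and> y (-1/2) = 0 \<and> y (1/2) = L}"

text \<open>
  Lebesgue integral of an extended real function as the difference of the integrals of its
  positive and negative parts (\<open>e2ennreal\<close> truncates at \<open>0\<close>).
\<close>

definition ereal_integral :: "real measure \<Rightarrow> (real \<Rightarrow> ereal) \<Rightarrow> ereal" where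
  "ereal_integral M h =
     enn2ereal (\<integral>\<^sup>+x. e2ennreal (h x) \<partial>M) - enn2ereal (\<integral>\<^sup>+x. e2ennreal (- h x) \<partial>M)"

text \<open>
  Weak derivatives are unique almost everywhere, so the value does not depend on the choice
  of \<open>g\<close>.  For \<open>W = \<phi>1 + \<phi>2\<close> the negative part of the integrand is integrable, so \<open>\<infinity> - \<infinity>\<close>
  does not occur.
\<close>

definition continuum_energy ::
  "(real \<Rightarrow> real) \<Rightarrow> (real \<Rightarrow> real) \<Rightarrow> real \<Rightarrow> (real \<Rightarrow> real) \<Rightarrow> ereal" where
  "continuum_energy W f L y =
     (let g = (SOME g. weak_deriv y g) in
      ereal_integral (lebesgue_on Omega)
        (\<lambda>x. ext_pot W (g x) + ereal (f x * (y x - L * (x + 1/2)))))"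

definition continuum_minimiser ::
  "(real \<Rightarrow> real) \<Rightarrow> (real \<Rightarrow> real) \<Rightarrow> real \<Rightarrow> (real \<Rightarrow> real) \<Rightarrow> bool" where
  "continuum_minimiser W f L y \<longleftrightarrow> y \<in> deformations L \<and>
     (\<forall>z \<in> deformations L. continuum_energy W f L y \<le> continuum_energy W f L z)"

text \<open>Classical derivative on \<open>Omega\<close>, one-sided at the end points.\<close>

definition D_Omega :: "(real \<Rightarrow> real) \<Rightarrow> real \<Rightarrow> real" where
  "D_Omega y x = vector_derivative y (at x within Omega)"


subsection \<open>The cell problem\<close>

definition ell2_Z :: "(int \<Rightarrow> real) set" where
  "ell2_Z = {r. (\<lambda>i. (r i)\<^sup>2) summable_on UNIV}"

definition Phi :: "(real \<Rightarrow> real) \<Rightarrow> real \<Rightarrow> real \<Rightarrow> real" where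
  "Phi \<phi> F0 t = \<phi> (F0 + t) - \<phi> F0 - deriv \<phi> F0 * t"

definition defect_energy ::
  "(real \<Rightarrow> real) \<Rightarrow> (real \<Rightarrow> real) \<Rightarrow> (real \<Rightarrow> real) \<Rightarrow> (real \<Rightarrow> real)
     \<Rightarrow> real \<Rightarrow> (int \<Rightarrow> real) \<Rightarrow> real" where
  "defect_energy \<phi>1 \<phi>2 \<psi>1 \<psi>2 F0 r =
       \<psi>2 (F0 + (r (-2) + r (-1)) / 2) - \<phi>2 (F0 + (r (-2) + r (-1)) / 2)
     + \<psi>1 (F0 + r (-1)) - \<phi>1 (F0 + r (-1))
     + \<psi>1 (F0 + r 0) - \<phi>1 (F0 + r 0)
     + \<psi>2 (F0 + (r 0 + r 1) / 2) - \<phi>2 (F0 + (r 0 + r 1) / 2)"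

text \<open>
  For \<open>r\<close> in \<open>\<ell>\<^sup>2\<close> with \<open>F0 + r i > 0\<close> for all \<open>i\<close>, the series converges absolutely, because
  \<open>Phi \<phi> F0\<close> is \<open>C\<^sup>2\<close> and vanishes to second order at \<open>0\<close>.
\<close>

definition cell_energy ::
  "(real \<Rightarrow> real) \<Rightarrow> (real \<Rightarrow> real) \<Rightarrow> (real \<Rightarrow> real) \<Rightarrow> (real \<Rightarrow> real)
     \<Rightarrow> real \<Rightarrow> (int \<Rightarrow> real) \<Rightarrow> ereal" where
  "cell_energy \<phi>1 \<phi>2 \<psi>1 \<psi>2 F0 r =
     (if \<exists>i. F0 + r i \<le> 0 then \<infinity>
      else ereal ((\<Sum>\<^sub>\<infinity>i\<in>UNIV. Phi \<phi>1 F0 (r i) + Phi \<phi>2 F0 ((r i + r (i + 1)) / 2))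
                  + defect_energy \<phi>1 \<phi>2 \<psi>1 \<psi>2 F0 r))"

definition cell_minimiser ::
  "(real \<Rightarrow> real) \<Rightarrow> (real \<Rightarrow> real) \<Rightarrow> (real \<Rightarrow> real) \<Rightarrow> (real \<Rightarrow> real)
     \<Rightarrow> real \<Rightarrow> (int \<Rightarrow> real) \<Rightarrow> bool" where
  "cell_minimiser \<phi>1 \<phi>2 \<psi>1 \<psi>2 F0 r \<longleftrightarrow> r \<in> ell2_Z \<and>
     (\<forall>s \<in> ell2_Z. cell_energy \<phi>1 \<phi>2 \<psi>1 \<psi>2 F0 r \<le> cell_energy \<phi>1 \<phi>2 \<psi>1 \<psi>2 F0 s)"

end

theory Submission
  imports Defs
begin

text \<open>
  At a site \<open>k \<ge> 2\<close> the defect terms are absent, so the Euler--Lagrange equation reads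
  \<open>w'(F0 + r k) - w'(F0) = P (r k) - (P a + P b) / 2\<close>, where \<open>w = \<phi>1 + \<phi>2\<close>, \<open>P t = \<phi>2'(F0 + t)\<close>,
  and \<open>a\<close>, \<open>b\<close> are the means of \<open>r k\<close> with its two neighbours.  As \<open>w'' \<ge> l\<close>, the left-hand side
  has the sign of \<open>r k\<close> and modulus at least \<open>l \<bar>r k\<bar>\<close>.  Since \<open>P\<close> is decreasing, \<open>\<bar>r\<bar>\<close> cannot have
  a nonzero local maximum at such a site, and as \<open>r\<close> tends to \<open>0\<close>, \<open>\<bar>r\<bar>\<close> is nonincreasing from site \<open>1\<close>
  on.  Then only the left neighbour contributes positively, and the Lipschitz bound on \<open>P\<close> gives
  \<open>l \<bar>r k\<bar> \<le> C/4 (\<bar>r (k - 1)\<bar> - \<bar>r k\<bar>)\<close>.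
\<close>

section \<open>Derivatives of the potentials and of \<open>Phi\<close>\<close>

text \<open>On an open set the derivative within the set is the full derivative, so the witnesses in
  \<open>C2_on\<close> agree there with \<open>deriv f\<close> and
  \<open>deriv (deriv f)\<close>.\<close>

lemma C2_on_deriv:
  assumes "C2_on S f" "open S" "x \<in> S"
  shows "(f has_real_derivative deriv f x) (at x)"
    and "(deriv f has_real_derivative deriv (deriv f) x) (at x)"
proof -
  obtain f' f'' where d: "\<forall>x\<in>S. (f has_real_derivative f' x) (at x within S)"
      "\<forall>x\<in>S. (f' has_real_derivative f'' x) (at x within S)"
    using assms(1) unfolding C2_on_def by blast
  have d1: "(f has_real_derivative f' y) (at y)" if "y \<in> S" for y
    using d(1) that assms(2) by (metis at_within_open)
  have eq: "deriv f y = f' y" if "y \<in> S" for y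
    using d1[OF that] by (rule DERIV_imp_deriv)
  show "(f has_real_derivative deriv f x) (at x)"
    using d1 eq assms(3) by simp
  have "(f' has_real_derivative f'' x) (at x)"
    using d(2) assms by (metis at_within_open)
  then have "(deriv f has_real_derivative f'' x) (at x)"
    by (rule has_field_derivative_transform_within_open[OF _ assms(2,3)]) (simp add: eq)
  then show "(deriv f has_real_derivative deriv (deriv f) x) (at x)"
    using DERIV_imp_deriv by metis
qed

lemma deriv_deriv_add:
  assumes "C2_on S f" "C2_on S g" "open S" "x \<in> S"
  shows "deriv (deriv (\<lambda>s. f s + g s)) x = deriv (deriv f) x + deriv (deriv g) x"
proof -
  have eq: "deriv (\<lambda>s. f s + g s) y = deriv f y + deriv g y" if "y \<in> S" for y
    by (intro DERIV_imp_deriv derivative_intros C2_on_deriv(1)[OF assms(1,3) that]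
        C2_on_deriv(1)[OF assms(2,3) that])
  have "((\<lambda>y. deriv f y + deriv g y) has_real_derivative deriv (deriv f) x + deriv (deriv g) x) (at x)"
    by (intro derivative_intros C2_on_deriv(2)[OF assms(1,3,4)] C2_on_deriv(2)[OF assms(2,3,4)])
  then have "(deriv (\<lambda>s. f s + g s) has_real_derivative deriv (deriv f) x + deriv (deriv g) x) (at x)"
    by (rule has_field_derivative_transform_within_open[OF _ assms(3,4)]) (simp add: eq)
  then show ?thesis by (rule DERIV_imp_deriv)
qed

lemma Phi_has_derivative:
  assumes "C2_on {0<..} \<phi>" "F0 + t > 0"
  shows "(Phi \<phi> F0 has_real_derivative deriv \<phi> (F0 + t) - deriv \<phi> F0) (at t)"
proof -
  have "(\<phi> has_real_derivative deriv \<phi> (F0 + t)) (at (F0 + t))"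
    using C2_on_deriv(1)[OF assms(1)] assms(2) by simp
  moreover have "((\<lambda>s. F0 + s) has_real_derivative 1) (at t)"
    by (auto intro!: derivative_eq_intros)
  ultimately have "((\<lambda>s. \<phi> (F0 + s)) has_real_derivative deriv \<phi> (F0 + t) * 1) (at t)"
    by (rule DERIV_chain2)
  then have "((\<lambda>s. \<phi> (F0 + s) - \<phi> F0 - deriv \<phi> F0 * s) has_real_derivative
      deriv \<phi> (F0 + t) - deriv \<phi> F0) (at t)"
    by (auto intro!: derivative_eq_intros)
  then show ?thesis unfolding Phi_def[abs_def] .
qed

text \<open>Two derivatives remove the affine part of \<open>Phi\<close>; this carries a bound on
  the second derivative of \<open>Phi \<phi>2 F0\<close> over to \<open>\<phi>2\<close>.\<close>

lemma deriv_deriv_Phi: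
  assumes "C2_on {0<..} \<phi>" "F0 + t > 0"
  shows "deriv (deriv (Phi \<phi> F0)) t = deriv (deriv \<phi>) (F0 + t)"
proof -
  have "(deriv \<phi> has_real_derivative deriv (deriv \<phi>) (F0 + t)) (at (F0 + t))"
    using C2_on_deriv(2)[OF assms(1)] assms(2) by simp
  moreover have "((\<lambda>s. F0 + s) has_real_derivative 1) (at t)"
    by (auto intro!: derivative_eq_intros)
  ultimately have "((\<lambda>s. deriv \<phi> (F0 + s)) has_real_derivative deriv (deriv \<phi>) (F0 + t) * 1) (at t)"
    by (rule DERIV_chain2)
  then have "((\<lambda>s. deriv \<phi> (F0 + s) - deriv \<phi> F0) has_real_derivative deriv (deriv \<phi>) (F0 + t)) (at t)"
    by (auto intro!: derivative_eq_intros)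
  then have "(deriv (Phi \<phi> F0) has_real_derivative deriv (deriv \<phi>) (F0 + t)) (at t)"
    by (rule has_field_derivative_transform_within_open[of _ _ _ "{- F0<..}"])
      (use assms in \<open>auto intro!: DERIV_imp_deriv[symmetric] Phi_has_derivative\<close>)
  then show ?thesis by (rule DERIV_imp_deriv)
qed

text \<open>Subtracting the tangent at \<open>F0\<close> makes \<open>Phi\<close> and its derivative
  vanish at 0. Differentiability of \<open>deriv \<phi>\<close> at \<open>F0\<close> bounds the
  derivative of \<open>Phi\<close> linearly, and the mean value inequality supplies the second
  power.\<close>

lemma Phi_quadratic_bound:
  assumes "C2_on {0<..} \<phi>" "F0 > 0"
  obtains K \<delta> where "\<delta> > 0" "\<And>t. \<bar>t\<bar> < \<delta> \<Longrightarrow> \<bar>Phi \<phi> F0 t\<bar> \<le> K * t\<^sup>2"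
proof -
  have "(deriv \<phi> has_real_derivative deriv (deriv \<phi>) F0) (at F0)"
    using C2_on_deriv(2)[OF assms(1)] assms(2) by simp
  then have "(\<lambda>h. (deriv \<phi> (F0 + h) - deriv \<phi> F0) / h) \<midarrow>0\<rightarrow> deriv (deriv \<phi>) F0"
    by (simp add: DERIV_def)
  from LIM_D[OF this, of 1] obtain d where d: "d > 0" "\<And>h. h \<noteq> 0 \<Longrightarrow> \<bar>h\<bar> < d \<Longrightarrow>
      \<bar>(deriv \<phi> (F0 + h) - deriv \<phi> F0) / h - deriv (deriv \<phi>) F0\<bar> < 1"
    by auto
  \<comment> \<open>For nonzero \<open>h\<close> below \<open>d\<close> the difference quotient is
    within 1 of the second derivative, hence \<open>K\<close>. The minimum with \<open>F0\<close>
    keeps \<open>F0 + t\<close> positive.\<close>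
  define K where "K = \<bar>deriv (deriv \<phi>) F0\<bar> + 1"
  define \<delta> where "\<delta> = min d F0"
  have K: "\<bar>deriv \<phi> (F0 + h) - deriv \<phi> F0\<bar> \<le> K * \<bar>h\<bar>" if "\<bar>h\<bar> < \<delta>" for h
  proof (cases "h = 0")
    case False
    then have "\<bar>(deriv \<phi> (F0 + h) - deriv \<phi> F0) / h\<bar> \<le> K"
      using d(2)[of h] that by (auto simp: K_def \<delta>_def)
    then show ?thesis using False by (simp add: abs_divide field_simps)
  qed simp
  have "\<bar>Phi \<phi> F0 t\<bar> \<le> K * t\<^sup>2" if t: "\<bar>t\<bar> < \<delta>" for t
  proof -
    have "norm (Phi \<phi> F0 t - Phi \<phi> F0 0) \<le> (K * \<bar>t\<bar>) * norm (t - 0)"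
    proof (rule field_differentiable_bound[of "cball 0 \<bar>t\<bar>"])
      fix z :: real assume z: "z \<in> cball 0 \<bar>t\<bar>"
      have "K \<ge> 0" by (simp add: K_def)
      have "K * \<bar>z\<bar> \<le> K * \<bar>t\<bar>" using z \<open>K \<ge> 0\<close> by (simp add: mult_left_mono)
      then show "norm (deriv \<phi> (F0 + z) - deriv \<phi> F0) \<le> K * \<bar>t\<bar>"
        using K[of z] z t by simp
      show "(Phi \<phi> F0 has_real_derivative deriv \<phi> (F0 + z) - deriv \<phi> F0) (at z within cball 0 \<bar>t\<bar>)"
        by (rule DERIV_subset[OF Phi_has_derivative[OF assms(1)] subset_UNIV])
          (use z t in \<open>auto simp: \<delta>_def\<close>)
    qed auto
    then show ?thesis by (simp add: Phi_def power2_eq_square mult.assoc)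
  qed
  moreover have "\<delta> > 0" using d(1) assms(2) by (simp add: \<delta>_def)
  ultimately show ?thesis using that by blast
qed

section \<open>Square-summable sequences and convergence of the energy series\<close>

text \<open>Otherwise a positive constant would be summable over an infinite set. In this form,
  decay at infinity yields attained maxima.\<close>

lemma ell2_finite_large:
  assumes "r \<in> ell2_Z" "\<epsilon> > 0"
  shows "finite {i. \<epsilon> \<le> \<bar>r i\<bar>}"
proof (rule ccontr)
  assume inf: "infinite {i. \<epsilon> \<le> \<bar>r i\<bar>}"
  have "(\<lambda>i. (r i)\<^sup>2) summable_on {i. \<epsilon> \<le> \<bar>r i\<bar>}"
    using assms(1) summable_on_subset_banach unfolding ell2_Z_def by blast
  then have "(\<lambda>i::int. \<epsilon>\<^sup>2) summable_on {i. \<epsilon> \<le> \<bar>r i\<bar>}"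
    by (rule summable_on_comparison_test)
      (use assms(2) in \<open>auto simp: abs_le_square_iff[symmetric]\<close>)
  then show False
    using infsum_diverge_constant[OF inf, of "\<epsilon>\<^sup>2"] assms(2) by simp
qed

lemma ell2_fun_upd:
  assumes "r \<in> ell2_Z"
  shows "r(k := t) \<in> ell2_Z"
proof -
  have "(\<lambda>i. (r i)\<^sup>2) summable_on (UNIV - {k})"
    using assms summable_on_subset_banach unfolding ell2_Z_def by blast
  then have "(\<lambda>i. ((r(k := t)) i)\<^sup>2) summable_on (UNIV - {k})"
    by (rule summable_on_cong[THEN iffD1, rotated]) auto
  then have "(\<lambda>i. ((r(k := t)) i)\<^sup>2) summable_on insert k (UNIV - {k})"
    by (subst summable_on_insert_iff)
  then show ?thesis by (simp add: ell2_Z_def insert_absorb)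
qed

lemma ell2_average:
  assumes "r \<in> ell2_Z"
  shows "(\<lambda>i. (r i + r (i + 1)) / 2) \<in> ell2_Z"
proof -
  have s: "(\<lambda>i. (r i)\<^sup>2) summable_on UNIV" using assms by (simp add: ell2_Z_def)
  have "bij (\<lambda>i::int. i + 1)" by (rule bij_betw_byWitness[of _ "\<lambda>i. i - 1"]) auto
  then have "(\<lambda>i. (r (i + 1))\<^sup>2) summable_on UNIV"
    using summable_on_reindex_bij_betw[of "\<lambda>i::int. i + 1" UNIV UNIV "\<lambda>i. (r i)\<^sup>2"] s by simp
  from summable_on_add[OF s this]
  have "(\<lambda>i. ((r i + r (i + 1)) / 2)\<^sup>2) summable_on UNIV"
  proof (rule summable_on_comparison_test)
    fix i
    \<comment> \<open>The expression is four times the difference of the two sides below.\<close>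
    have "0 \<le> (r i - r (i + 1))\<^sup>2 + 2 * (r i)\<^sup>2 + 2 * (r (i + 1))\<^sup>2" by simp
    then show "((r i + r (i + 1)) / 2)\<^sup>2 \<le> (r i)\<^sup>2 + (r (i + 1))\<^sup>2"
      by (simp add: power2_eq_square field_simps)
  qed auto
  then show ?thesis by (simp add: ell2_Z_def)
qed

text \<open>The quadratic bound dominates all terms off the finite set where \<open>r\<close> is
  large. Since \<open>infsum\<close> of a nonsummable family is 0 by convention, convergence must be
  known before two energies are subtracted termwise.\<close>

lemma Phi_summable:
  assumes "C2_on {0<..} \<phi>" "F0 > 0" "r \<in> ell2_Z"
  shows "(\<lambda>i. Phi \<phi> F0 (r i)) summable_on UNIV"
proof -
  obtain K \<delta> where K: "\<delta> > 0" "\<And>t. \<bar>t\<bar> < \<delta> \<Longrightarrow> \<bar>Phi \<phi> F0 t\<bar> \<le> K * t\<^sup>2"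
    using Phi_quadratic_bound[OF assms(1,2)] by blast
  define A where "A = {i. \<delta> \<le> \<bar>r i\<bar>}"
  have "finite A" unfolding A_def by (rule ell2_finite_large[OF assms(3) K(1)])
  have "(\<lambda>i. (r i)\<^sup>2) summable_on (- A)"
    using assms(3) summable_on_subset_banach unfolding ell2_Z_def by blast
  then have "(\<lambda>i. K * (r i)\<^sup>2) summable_on (- A)"
    by (rule summable_on_cmult_right)
  then have "(\<lambda>i. \<bar>Phi \<phi> F0 (r i)\<bar>) summable_on (- A)"
    by (rule summable_on_comparison_test) (use K(2) in \<open>auto simp: A_def\<close>)
  then have "(\<lambda>i. Phi \<phi> F0 (r i)) summable_on (- A)"
    by (subst summable_on_iff_abs_summable_on_real) simp
  moreover have "(\<lambda>i. Phi \<phi> F0 (r i)) summable_on A"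
    using \<open>finite A\<close> by (rule summable_on_finite)
  ultimately have "(\<lambda>i. Phi \<phi> F0 (r i)) summable_on (- A \<union> A)"
    by (intro summable_on_Un_disjoint) auto
  then show ?thesis by simp
qed

section \<open>Minimisers of the cell energy and their Euler-Lagrange equation\<close>

text \<open>The zero sequence is a competitor of finite energy because
  \<open>F0 > 0\<close>.\<close>

lemma cell_minimiser_positive:
  assumes "cell_minimiser \<phi>1 \<phi>2 \<psi>1 \<psi>2 F0 r" "F0 > 0"
  shows "F0 + r i > 0"
proof (rule ccontr)
  assume "\<not> F0 + r i > 0"
  then have "cell_energy \<phi>1 \<phi>2 \<psi>1 \<psi>2 F0 r = \<infinity>"
    unfolding cell_energy_def by (auto simp: not_less)
  moreover have "(\<lambda>_. 0) \<in> ell2_Z" by (simp add: ell2_Z_def)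
  then have "cell_energy \<phi>1 \<phi>2 \<psi>1 \<psi>2 F0 r \<le> cell_energy \<phi>1 \<phi>2 \<psi>1 \<psi>2 F0 (\<lambda>_. 0)"
    using assms(1) unfolding cell_minimiser_def by blast
  ultimately show False using assms(2) by (simp add: cell_energy_def)
qed

text \<open>Comparing \<open>r\<close> with the sequence changed only at site \<open>k\<close>
  reduces the infinite-dimensional problem to minimality of a function of one variable.\<close>

lemma cell_minimiser_site:
  assumes C2: "C2_on {0<..} \<phi>1" "C2_on {0<..} \<phi>2"
    and min: "cell_minimiser \<phi>1 \<phi>2 \<psi>1 \<psi>2 F0 r" and F0: "F0 > 0"
    and k: "k \<ge> 2" and t: "F0 + t > 0"
  shows "Phi \<phi>1 F0 (r k) + Phi \<phi>2 F0 ((r (k - 1) + r k) / 2) + Phi \<phi>2 F0 ((r k + r (k + 1)) / 2)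
    \<le> Phi \<phi>1 F0 t + Phi \<phi>2 F0 ((r (k - 1) + t) / 2) + Phi \<phi>2 F0 ((t + r (k + 1)) / 2)"
proof -
  define e where "e s i = Phi \<phi>1 F0 (s i) + Phi \<phi>2 F0 ((s i + s (i + 1)) / 2)"
    for s :: "int \<Rightarrow> real" and i
  define s where "s = r(k := t)"
  have r: "r \<in> ell2_Z" using min by (simp add: cell_minimiser_def)
  then have s: "s \<in> ell2_Z" unfolding s_def by (rule ell2_fun_upd)
  have pos: "F0 + r i > 0" for i by (rule cell_minimiser_positive[OF min F0])
  then have pos': "F0 + s i > 0" for i using t by (simp add: s_def)
  have sum: "e u summable_on UNIV" if "u \<in> ell2_Z" for u
    unfolding e_def
    by (rule summable_on_add[OF Phi_summable[OF C2(1) F0 that]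
          Phi_summable[OF C2(2) F0 ell2_average[OF that]]])
  \<comment> \<open>The defect reads only the sites -2 to 1; this is where \<open>k \<ge> 2\<close>
    enters.\<close>
  have def_eq: "defect_energy \<phi>1 \<phi>2 \<psi>1 \<psi>2 F0 s = defect_energy \<phi>1 \<phi>2 \<psi>1 \<psi>2 F0 r"
    using k by (simp add: defect_energy_def s_def)
  have "cell_energy \<phi>1 \<phi>2 \<psi>1 \<psi>2 F0 r \<le> cell_energy \<phi>1 \<phi>2 \<psi>1 \<psi>2 F0 s"
    using min s by (simp add: cell_minimiser_def)
  moreover have "cell_energy \<phi>1 \<phi>2 \<psi>1 \<psi>2 F0 r =
      ereal (infsum (e r) UNIV + defect_energy \<phi>1 \<phi>2 \<psi>1 \<psi>2 F0 r)"
    using pos by (simp add: cell_energy_def e_def[abs_def] not_le)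
  moreover have "cell_energy \<phi>1 \<phi>2 \<psi>1 \<psi>2 F0 s =
      ereal (infsum (e s) UNIV + defect_energy \<phi>1 \<phi>2 \<psi>1 \<psi>2 F0 s)"
    using pos' by (simp add: cell_energy_def e_def[abs_def] not_le)
  ultimately have "infsum (e r) UNIV \<le> infsum (e s) UNIV"
    using def_eq by simp
  moreover have "((\<lambda>i. e s i + - e r i) has_sum (infsum (e s) UNIV + - infsum (e r) UNIV)) UNIV"
    using sum[OF s] sum[OF r] by (intro has_sum_add has_sum_uminusI) auto
  ultimately have "0 \<le> infsum (\<lambda>i. e s i - e r i) UNIV"
    by (simp add: infsumI)
  \<comment> \<open>The summand \<open>e s i\<close> reads sites \<open>i\<close> and
    \<open>i + 1\<close>, so site \<open>k\<close> occurs only for \<open>i = k - 1\<close> and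
    \<open>i = k\<close>.\<close>
  also have "infsum (\<lambda>i. e s i - e r i) UNIV = infsum (\<lambda>i. e s i - e r i) {k - 1, k}"
    by (rule infsum_cong_neutral) (auto simp: e_def s_def)
  finally show ?thesis by (simp add: e_def s_def)
qed

lemma cell_minimiser_Euler_Lagrange:
  assumes C2: "C2_on {0<..} \<phi>1" "C2_on {0<..} \<phi>2"
    and min: "cell_minimiser \<phi>1 \<phi>2 \<psi>1 \<psi>2 F0 r" and F0: "F0 > 0" and k: "k \<ge> 2"
  shows "(deriv \<phi>1 (F0 + r k) - deriv \<phi>1 F0)
    + (deriv \<phi>2 (F0 + (r (k - 1) + r k) / 2) - deriv \<phi>2 F0) / 2
    + (deriv \<phi>2 (F0 + (r k + r (k + 1)) / 2) - deriv \<phi>2 F0) / 2 = 0"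
proof -
  have pos: "F0 + r i > 0" for i by (rule cell_minimiser_positive[OF min F0])
  have pos2: "F0 + (r i + r j) / 2 > 0" for i j
    using pos[of i] pos[of j] by (simp add: field_simps)
  have d1: "((\<lambda>t. (r (k - 1) + t) / 2) has_real_derivative 1/2) (at (r k))"
    and d2: "((\<lambda>t. (t + r (k + 1)) / 2) has_real_derivative 1/2) (at (r k))"
    by (auto intro!: derivative_eq_intros)
  have D: "((\<lambda>t. Phi \<phi>1 F0 t + Phi \<phi>2 F0 ((r (k - 1) + t) / 2) + Phi \<phi>2 F0 ((t + r (k + 1)) / 2))
      has_real_derivative
      (deriv \<phi>1 (F0 + r k) - deriv \<phi>1 F0)
      + (deriv \<phi>2 (F0 + (r (k - 1) + r k) / 2) - deriv \<phi>2 F0) * (1/2)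
      + (deriv \<phi>2 (F0 + (r k + r (k + 1)) / 2) - deriv \<phi>2 F0) * (1/2)) (at (r k))"
    by (intro DERIV_add Phi_has_derivative[OF C2(1) pos]
        DERIV_chain2[OF Phi_has_derivative[OF C2(2) pos2] d1]
        DERIV_chain2[OF Phi_has_derivative[OF C2(2) pos2] d2])
  \<comment> \<open>Within the radius \<open>F0 + r k\<close> every \<open>t\<close> still satisfies
    \<open>F0 + t > 0\<close>.\<close>
  have "\<forall>t. \<bar>r k - t\<bar> < F0 + r k \<longrightarrow>
      Phi \<phi>1 F0 (r k) + Phi \<phi>2 F0 ((r (k - 1) + r k) / 2) + Phi \<phi>2 F0 ((r k + r (k + 1)) / 2)
      \<le> Phi \<phi>1 F0 t + Phi \<phi>2 F0 ((r (k - 1) + t) / 2) + Phi \<phi>2 F0 ((t + r (k + 1)) / 2)"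
    by (auto intro!: cell_minimiser_site[OF C2 min F0 k])
  from DERIV_local_min[OF D pos this] show ?thesis by simp
qed

section \<open>Decreasing derivatives and midpoint estimates\<close>

text \<open>The tangent inequalities of the convex function \<open>- \<phi>\<close> at
  \<open>x\<close> and at \<open>y\<close> are added.\<close>

lemma concave_on_deriv_antimono:
  assumes "concave_on {0<..} \<phi>" "C2_on {0<..} \<phi>" "0 < x" "x \<le> y"
  shows "deriv \<phi> y \<le> deriv \<phi> x"
proof (cases "x = y")
  case False
  have d: "((\<lambda>t. - \<phi> t) has_real_derivative - deriv \<phi> u) (at u within {0<..})" if "u > 0" for u
    by (rule DERIV_subset[OF DERIV_minus[OF C2_on_deriv(1)[OF assms(2)]] subset_UNIV])
      (use that in auto)
  have tan: "- \<phi> v - (- \<phi> u) \<ge> (- deriv \<phi> u) * (v - u)" if "u > 0" "v > 0" for u v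
    by (rule convex_on_imp_above_tangent[OF _ _ _ _ d[OF that(1)]])
      (use assms(1) that in \<open>auto simp: concave_on_def interior_open\<close>)
  have "(y - x) * (deriv \<phi> x - deriv \<phi> y) \<ge> 0"
    using tan[of x y] tan[of y x] assms(3,4) by (simp add: algebra_simps)
  then show ?thesis using False assms(4) by (simp add: zero_le_mult_iff)
qed simp

text \<open>The midpoint lies to the left of a positive \<open>x\<close> and to the right of a
  negative one, or equals \<open>x\<close>. Thus a neighbour of no larger modulus contributes
  nothing positive.\<close>

lemma antimono_midpoint_nonpos:
  fixes P :: "real \<Rightarrow> real"
  assumes "\<And>u v. a < u \<Longrightarrow> u \<le> v \<Longrightarrow> P v \<le> P u" "a < x" "a < y" "\<bar>y\<bar> \<le> \<bar>x\<bar>"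
  shows "sgn x * (P x - P ((x + y) / 2)) \<le> 0"
proof (cases x "0::real" rule: linorder_cases)
  case less
  then show ?thesis using assms(1)[of x "(x + y) / 2"] assms(2-) by simp
next
  case greater
  then show ?thesis using assms(1)[of "(x + y) / 2" x] assms(2-) by simp
qed simp

text \<open>If \<open>y\<close> lies beyond \<open>x\<close> on the same side of 0, the midpoint is
  at distance \<open>(\<bar>y\<bar> - \<bar>x\<bar>) / 2\<close> from \<open>x\<close> and
  \<open>lip\<close> applies. If \<open>y\<close> lies on the other side, the distance is too large
  for this, but monotonicity alone makes the left-hand side nonpositive.\<close>

lemma lipschitz_midpoint_bound:
  fixes P :: "real \<Rightarrow> real"
  assumes anti: "\<And>u v. a < u \<Longrightarrow> u \<le> v \<Longrightarrow> P v \<le> P u"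
    and lip: "\<And>u v. a < u \<Longrightarrow> - R \<le> u \<Longrightarrow> u \<le> v \<Longrightarrow> v \<le> R \<Longrightarrow> P u - P v \<le> C * (v - u)"
    and "a < x" "a < y" "\<bar>x\<bar> \<le> \<bar>y\<bar>" "\<bar>y\<bar> \<le> R" "C \<ge> 0"
  shows "sgn x * (P x - P ((x + y) / 2)) \<le> C / 2 * (\<bar>y\<bar> - \<bar>x\<bar>)"
proof -
  have C0: "0 \<le> C / 2 * (\<bar>y\<bar> - \<bar>x\<bar>)" using assms by simp
  consider "x = 0" | "x > 0" "y \<ge> x" | "x > 0" "y < x" | "x < 0" "y \<le> x" | "x < 0" "y > x"
    by linarith
  then show ?thesis
  proof cases
    case 1 then show ?thesis using C0 by simp
  next
    case 2
    then show ?thesis using lip[of x "(x + y) / 2"] assms(3-) by (simp add: field_simps)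
  next
    case 3
    then show ?thesis using anti[of "(x + y) / 2" x] assms(3-) C0 by (simp add: field_simps)
  next
    case 4
    then show ?thesis using lip[of "(x + y) / 2" x] assms(3-) by (simp add: field_simps)
  next
    case 5
    then show ?thesis using anti[of x "(x + y) / 2"] assms(3-) C0 by (simp add: field_simps)
  qed
qed

section \<open>From the difference inequality to geometric decay\<close>

lemma difference_inequality_decay:
  fixes r :: "int \<Rightarrow> real" and P :: "real \<Rightarrow> real"
  assumes fin: "\<And>\<epsilon>. \<epsilon> > 0 \<Longrightarrow> finite {i. \<epsilon> \<le> \<bar>r i\<bar>}"
    and dom: "\<And>i. a < r i"
    and anti: "\<And>u v. a < u \<Longrightarrow> u \<le> v \<Longrightarrow> P v \<le> P u"
    and lip: "\<And>u v. a < u \<Longrightarrow> - \<bar>r 1\<bar> \<le> u \<Longrightarrow> u \<le> v \<Longrightarrow> v \<le> \<bar>r 1\<bar> \<Longrightarrow> P u - P v \<le> C * (v - u)"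
    and l: "l > 0" and C: "C \<ge> 0"
    and ineq: "\<And>k. k \<ge> 2 \<Longrightarrow> l * \<bar>r k\<bar> \<le> sgn (r k) *
      (P (r k) - P ((r k + r (k - 1)) / 2) / 2 - P ((r k + r (k + 1)) / 2) / 2)"
    and i: "i \<ge> 1"
  shows "\<bar>r i\<bar> \<le> (C / (l + C)) ^ nat (i - 1) * \<bar>r 1\<bar>"
proof -
  \<comment> \<open>Up to the factor 2, \<open>q k j\<close> is the share of neighbour
    \<open>j\<close> in the inequality at site \<open>k\<close>.\<close>
  define q where "q k j = sgn (r k) * (P (r k) - P ((r k + r j) / 2))" for k j
  have ineq': "2 * l * \<bar>r k\<bar> \<le> q k (k - 1) + q k (k + 1)" if "k \<ge> 2" for k
    using ineq[OF that] by (simp add: q_def algebra_simps)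
  have q0: "q k j \<le> 0" if "\<bar>r j\<bar> \<le> \<bar>r k\<bar>" for k j
    unfolding q_def by (rule antimono_midpoint_nonpos[of a]) (use anti dom that in auto)
  have mono: "\<bar>r j\<bar> \<le> \<bar>r k\<bar>" if kj: "1 \<le> k" "k < j" for j k
  proof (rule ccontr)
    assume "\<not> \<bar>r j\<bar> \<le> \<bar>r k\<bar>"
    then have less: "\<bar>r k\<bar> < \<bar>r j\<bar>" by simp
    \<comment> \<open>A violation of monotonicity makes the modulus positive at \<open>j\<close>, so
      \<open>A\<close> is finite and the modulus attains a maximum on it.\<close>
    define A where "A = {i. k < i \<and> \<bar>r j\<bar> \<le> \<bar>r i\<bar>}"
    have "finite A"
      by (rule finite_subset[OF _ fin[of "\<bar>r j\<bar>"]]) (use less in \<open>auto simp: A_def\<close>)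
    moreover have "A \<noteq> {}" using kj by (auto simp: A_def)
    ultimately have "Max ((\<lambda>i. \<bar>r i\<bar>) ` A) \<in> (\<lambda>i. \<bar>r i\<bar>) ` A"
      by (intro Max_in) auto
    then obtain m where "m \<in> A" and Max: "Max ((\<lambda>i. \<bar>r i\<bar>) ` A) = \<bar>r m\<bar>" by blast
    then have m: "m \<in> A" "\<And>i. i \<in> A \<Longrightarrow> \<bar>r i\<bar> \<le> \<bar>r m\<bar>"
      using \<open>finite A\<close> by (auto simp flip: Max)
    \<comment> \<open>The maximum over \<open>A\<close> bounds all sites from \<open>k\<close> on,
      hence also \<open>m - 1\<close>, which may be \<open>k\<close> itself.\<close>
    have max: "\<bar>r i\<bar> \<le> \<bar>r m\<bar>" if "k \<le> i" for i
    proof (cases "i \<in> A")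
      case False
      then have "\<bar>r i\<bar> \<le> \<bar>r j\<bar>" using that less by (cases "i = k") (auto simp: A_def)
      then show ?thesis using m(1) by (simp add: A_def)
    qed (use m(2) in auto)
    have "k < m" "r m \<noteq> 0" using m(1) less by (auto simp: A_def)
    then have "2 * l * \<bar>r m\<bar> \<le> 0"
      using ineq'[of m] q0[OF max, of "m - 1"] q0[OF max, of "m + 1"] kj(1) by simp
    then show False using l \<open>r m \<noteq> 0\<close> by (simp add: mult_le_0_iff)
  qed
  have contract: "\<bar>r k\<bar> \<le> C / (l + C) * \<bar>r (k - 1)\<bar>" if k: "k \<ge> 2" for k
  proof -
    have 1: "\<bar>r k\<bar> \<le> \<bar>r (k - 1)\<bar>" using mono[of "k - 1" k] k by simp
    \<comment> \<open>This keeps the left neighbour in the interval where \<open>lip\<close> is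
      available.\<close>
    have 2: "\<bar>r (k - 1)\<bar> \<le> \<bar>r 1\<bar>" using mono[of 1 "k - 1"] k by (cases "k = 2") auto
    have "q k (k - 1) \<le> C / 2 * (\<bar>r (k - 1)\<bar> - \<bar>r k\<bar>)"
      unfolding q_def
      by (rule lipschitz_midpoint_bound[where a = a and R = "\<bar>r 1\<bar>"])
        (use anti lip dom 1 2 C in auto)
    moreover have "q k (k + 1) \<le> 0"
      by (rule q0) (use mono[of k "k + 1"] k in simp)
    ultimately have "2 * l * \<bar>r k\<bar> \<le> C / 2 * (\<bar>r (k - 1)\<bar> - \<bar>r k\<bar>)"
      using ineq'[OF k] by linarith
    moreover have "0 \<le> C * (\<bar>r (k - 1)\<bar> - \<bar>r k\<bar>)" using C 1 by simp
    moreover have "0 \<le> l * \<bar>r k\<bar>" using l by simp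
    \<comment> \<open>The estimates give this with \<open>4 * l + C\<close> on the left;
      \<open>4 * l\<close> is then lowered to \<open>l\<close>.\<close>
    ultimately have "(l + C) * \<bar>r k\<bar> \<le> C * \<bar>r (k - 1)\<bar>"
      by (simp add: algebra_simps)
    then show ?thesis using l C by (simp add: field_simps)
  qed
  show ?thesis
    using i
  proof (induction i rule: int_ge_induct)
    case base
    show ?case by simp
  next
    case (step i)
    have "\<bar>r (i + 1)\<bar> \<le> C / (l + C) * \<bar>r i\<bar>" using contract[of "i + 1"] step.hyps by simp
    also have "\<dots> \<le> C / (l + C) * ((C / (l + C)) ^ nat (i - 1) * \<bar>r 1\<bar>)"
      using step.IH l C by (intro mult_left_mono) auto
    also have "\<dots> = (C / (l + C)) ^ nat (i + 1 - 1) * \<bar>r 1\<bar>"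
    proof -
      have "nat (i + 1 - 1) = Suc (nat (i - 1))" using step.hyps by simp
      then show ?thesis by simp
    qed
    finally show ?case .
  qed
qed

section \<open>The difference inequality for the minimiser\<close>

theorem mainTheorem3:
  fixes \<phi>1 \<phi>2 \<psi>1 \<psi>2 f ybar :: "real \<Rightarrow> real"
    and l \<alpha> C0 L F0 C :: real
    and r :: "int \<Rightarrow> real"
  assumes "admissible_potentials \<phi>1 \<phi>2 \<psi>1 \<psi>2 l \<alpha> C0"
    and "L > 0"
    and "C2_on Omega f"
    and "continuum_minimiser (\<lambda>t. \<phi>1 t + \<phi>2 t) f L ybar"
    and "C2_on Omega ybar"
    and "\<forall>x\<in>Omega. D_Omega ybar x > 0"
    and "F0 = D_Omega ybar 0"
    and "cell_minimiser \<phi>1 \<phi>2 \<psi>1 \<psi>2 F0 r"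
    and "C \<ge> 0"
    and "\<forall>t. - \<bar>r 1\<bar> < t \<and> t < \<bar>r 1\<bar> \<and> F0 + t > 0 \<longrightarrow>
            0 \<ge> deriv (deriv (Phi \<phi>2 F0)) t \<and> deriv (deriv (Phi \<phi>2 F0)) t \<ge> - C"
  shows "\<forall>i\<ge>1. \<bar>r i\<bar> \<le> (C / (l + C)) ^ nat (i - 1) * \<bar>r 1\<bar>"
proof (intro allI impI)
  fix i :: int assume i: "i \<ge> 1"
  have l: "l > 0" and C2: "C2_on {0<..} \<phi>1" "C2_on {0<..} \<phi>2"
    and conc: "concave_on {0<..} \<phi>2"
    and W: "\<And>t. t > 0 \<Longrightarrow> deriv (deriv (\<lambda>s. \<phi>1 s + \<phi>2 s)) t \<ge> l"
    using assms(1) by (auto simp: admissible_potentials_def)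
  have F0: "F0 > 0" using assms(6,7) by (simp add: Omega_def)
  note min = assms(8)
  have pos: "F0 + r k > 0" for k by (rule cell_minimiser_positive[OF min F0])
  \<comment> \<open>Strong monotonicity of the derivative of \<open>\<phi>1 + \<phi>2\<close>
    between \<open>F0\<close> and \<open>F0 + t\<close>; the factor \<open>sgn t\<close> covers both
    orders of these points.\<close>
  have conv: "l * \<bar>t\<bar> \<le> sgn t * ((deriv \<phi>1 (F0 + t) + deriv \<phi>2 (F0 + t)) - (deriv \<phi>1 F0 + deriv \<phi>2 F0))"
    if t: "F0 + t > 0" for t
  proof -
    define g where "g = (\<lambda>x. deriv \<phi>1 x + deriv \<phi>2 x)"
    have inc: "l * (y - x) \<le> g y - g x" if xy: "0 < x" "x < y" for x y
    proof -
      have "\<exists>z. x < z \<and> z < y \<and> g y - g x = (y - x) * (deriv (deriv \<phi>1) z + deriv (deriv \<phi>2) z)"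
        unfolding g_def
        by (rule MVT2[OF xy(2)]) (use C2 xy in \<open>auto intro!: DERIV_add C2_on_deriv(2)\<close>)
      then obtain z where z: "x < z" "g y - g x = (y - x) * (deriv (deriv \<phi>1) z + deriv (deriv \<phi>2) z)"
        by blast
      moreover have "deriv (deriv \<phi>1) z + deriv (deriv \<phi>2) z \<ge> l"
        using W[of z] deriv_deriv_add[OF C2, of z] z(1) xy(1) by simp
      ultimately show ?thesis using xy by (simp add: mult.commute mult_left_mono)
    qed
    show ?thesis
      using inc[of F0 "F0 + t"] inc[of "F0 + t" F0] t F0
      by (cases t "0::real" rule: linorder_cases) (simp_all add: g_def)
  qed
  show "\<bar>r i\<bar> \<le> (C / (l + C)) ^ nat (i - 1) * \<bar>r 1\<bar>"
  proof (rule difference_inequality_decay[where a = "- F0" and P = "\<lambda>t. deriv \<phi>2 (F0 + t)"])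
    show "finite {i. \<epsilon> \<le> \<bar>r i\<bar>}" if "\<epsilon> > 0" for \<epsilon>
      using min that by (auto simp: cell_minimiser_def intro: ell2_finite_large)
    show "- F0 < r k" for k using pos[of k] by simp
    show "deriv \<phi>2 (F0 + v) \<le> deriv \<phi>2 (F0 + u)" if "- F0 < u" "u \<le> v" for u v
      by (rule concave_on_deriv_antimono[OF conc C2(2)]) (use that in auto)
    show "deriv \<phi>2 (F0 + u) - deriv \<phi>2 (F0 + v) \<le> C * (v - u)"
      if uv: "- F0 < u" "- \<bar>r 1\<bar> \<le> u" "u \<le> v" "v \<le> \<bar>r 1\<bar>" for u v
    proof (cases "u = v")
      case False
      have "\<exists>z. F0 + u < z \<and> z < F0 + v \<and>
          deriv \<phi>2 (F0 + v) - deriv \<phi>2 (F0 + u) = ((F0 + v) - (F0 + u)) * deriv (deriv \<phi>2) z"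
        by (rule MVT2) (use C2 uv False in \<open>auto intro!: C2_on_deriv(2)\<close>)
      then obtain z where z: "F0 + u < z" "z < F0 + v"
          "deriv \<phi>2 (F0 + v) - deriv \<phi>2 (F0 + u) = (v - u) * deriv (deriv \<phi>2) z"
        by auto
      \<comment> \<open>The mean value point is strictly between the end points, so
        \<open>z - F0\<close> is in the open interval of the hypothesis even if \<open>u\<close> or
        \<open>v\<close> is at its boundary.\<close>
      have "deriv (deriv (Phi \<phi>2 F0)) (z - F0) \<ge> - C"
        using assms(10)[rule_format, of "z - F0"] z uv by simp
      then have "deriv (deriv \<phi>2) z \<ge> - C"
        using deriv_deriv_Phi[OF C2(2), of F0 "z - F0"] z uv by simp
      then have "(v - u) * deriv (deriv \<phi>2) z \<ge> (v - u) * (- C)"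
        using uv by (intro mult_left_mono) auto
      then show ?thesis using z(3) by (simp add: algebra_simps)
    qed simp
    show "l * \<bar>r k\<bar> \<le> sgn (r k) * (deriv \<phi>2 (F0 + r k)
        - deriv \<phi>2 (F0 + (r k + r (k - 1)) / 2) / 2 - deriv \<phi>2 (F0 + (r k + r (k + 1)) / 2) / 2)"
      if k: "k \<ge> 2" for k
    proof -
      \<comment> \<open>Adding \<open>y\<close>, the value of \<open>deriv \<phi>2\<close> at
        \<open>F0 + r k\<close>, completes \<open>x\<close> to the derivative of
        \<open>\<phi>1 + \<phi>2\<close>; the two halves of \<open>q\<close> cancel against
        \<open>q\<close>.\<close>
      have rearrange: "x + y - (p + q) = y - a / 2 - b / 2" if "x - p + (a - q) / 2 + (b - q) / 2 = 0"
        for x y p q a b :: real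
        using that by (simp add: field_simps)
      have "deriv \<phi>1 (F0 + r k) + deriv \<phi>2 (F0 + r k) - (deriv \<phi>1 F0 + deriv \<phi>2 F0)
          = deriv \<phi>2 (F0 + r k)
            - deriv \<phi>2 (F0 + (r k + r (k - 1)) / 2) / 2 - deriv \<phi>2 (F0 + (r k + r (k + 1)) / 2) / 2"
        by (rule rearrange[OF cell_minimiser_Euler_Lagrange[OF C2 min F0 k, unfolded add.commute[of "r (k - 1)"]]])
      then show ?thesis using conv[OF pos[of k]] by (simp only:)
    qed
  qed (use l assms(9) i in auto)
qed

end
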